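(* Let $p\ge2$, let $\mu$ be a Borel probability measure on $\mathbb S^{p-1}$, and let $\gamma:J\to\mathbb S^{p-1}$ be a nonconstant regular $C^1$ immersion of an interval $J$. Suppose that $\mu$ has a nonzero component along this arc: for some measurable $h\ge0$ on $J$, positive on a set of positive Lebesgue measure, $$\mu\ge\gamma_\#\{h(s)\,\mathrm ds\}.$$ Then $$\sigma\{u\in\mathbb S^{p-1}:I_\mu(u)=\infty\}>0 .$$
   Context: $\sigma$ is Haar (uniform) probability measure on $\mathbb S^{p-1}$; $I_\mu(u):=\int_{\mathbb S^{p-1}}|a^\top u|^{-1}\,\mu(\mathrm da)\in[0,\infty]$ with integrand $+\infty$ when $a^\top u=0$; $\gamma_\#$ denotes pushforward. *)

theory Defs
  imports "HOL-Probability.Probability"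
begin

abbreviation borel_sphere :: "(real ^ 'n) measure" where
  "borel_sphere \<equiv> restrict_space borel (sphere 0 1)"

definition borel_prob_on_sphere :: "(real ^ 'n) measure \<Rightarrow> bool" where
  "borel_prob_on_sphere \<mu> \<longleftrightarrow> prob_space \<mu> \<and> sets \<mu> = sets borel_sphere"

text \<open>Haar (uniform) probability measure on the unit sphere: the Borel probability measure
  invariant under the orthogonal group.\<close>

definition haar_on_sphere :: "(real ^ 'n) measure \<Rightarrow> bool" where
  "haar_on_sphere \<sigma> \<longleftrightarrow> borel_prob_on_sphere \<sigma> \<and>
     (\<forall>f. orthogonal_transformation f \<longrightarrow> distr \<sigma> borel_sphere f = \<sigma>)"

text \<open>In \<^typ>\<open>ennreal\<close> one has \<open>inverse 0 = \<infinity>\<close>, so the integrand is \<open>\<infinity>\<close> where \<open>a \<bullet> u = 0\<close>.\<close>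

definition I_pot :: "(real ^ 'n) measure \<Rightarrow> real ^ 'n \<Rightarrow> ennreal" where
  "I_pot \<mu> u = (\<integral>\<^sup>+ a. inverse (ennreal \<bar>a \<bullet> u\<bar>) \<partial>\<mu>)"

text \<open>The derivative is taken within \<open>J\<close>, so it is one-sided at endpoints belonging to \<open>J\<close>.\<close>

definition C1_immersion_on :: "(real \<Rightarrow> 'a::real_normed_vector) \<Rightarrow> real set \<Rightarrow> bool" where
  "C1_immersion_on \<gamma> J \<longleftrightarrow> (\<exists>\<gamma>'. continuous_on J \<gamma>' \<and>
     (\<forall>s\<in>J. (\<gamma> has_vector_derivative \<gamma>' s) (at s within J) \<and> \<gamma>' s \<noteq> 0))"

text \<open>The pushforward of \<open>h(s) ds\<close> on \<open>J\<close> under \<open>\<gamma>\<close>, with \<open>ds\<close> Lebesgue measure.\<close>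

definition arc_measure :: "(real \<Rightarrow> real ^ 'n) \<Rightarrow> real set \<Rightarrow> (real \<Rightarrow> real) \<Rightarrow> (real ^ 'n) measure" where
  "arc_measure \<gamma> J h = distr (density (lebesgue_on J) (\<lambda>s. ennreal (h s))) borel_sphere \<gamma>"

text \<open>\<open>distr\<close> is the pushforward only for measurable maps, so measurability of the arc is
  recorded here.\<close>

lemma measurable_arc:
  fixes \<gamma> :: "real \<Rightarrow> real ^ 'n"
  assumes "is_interval J" "C1_immersion_on \<gamma> J" "\<gamma> ` J \<subseteq> sphere 0 1"
  shows "\<gamma> \<in> lebesgue_on J \<rightarrow>\<^sub>M borel_sphere"
proof -
  have "continuous_on J \<gamma>"
    using assms(2) unfolding C1_immersion_on_def
    by (meson continuous_on_eq_continuous_within has_vector_derivative_continuous)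
  moreover have "J \<in> sets borel"
    using assms(1) by (rule real_interval_borel_measurable)
  ultimately have "\<gamma> \<in> borel_measurable (lebesgue_on J)"
    by (intro continuous_imp_measurable_on_sets_lebesgue) auto
  then show ?thesis
    using assms(3) by (intro measurable_restrict_space2) auto
qed

text \<open>Existence of a measure satisfying \<open>haar_on_sphere\<close>: the radial projection of the uniform measure on the unit ball.\<close>

lemma borel_measurable_orthogonal:
  fixes f :: "real ^ 'n \<Rightarrow> real ^ 'n"
  assumes "orthogonal_transformation f"
  shows "f \<in> borel_measurable borel"
  using orthogonal_transformation_linear[OF assms]
  by (intro borel_measurable_continuous_onI linear_continuous_on)
    (simp add: linear_conv_bounded_linear)

lemma distr_lborel_orthogonal:
  fixes f :: "real ^ 'n \<Rightarrow> real ^ 'n"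
  assumes f: "orthogonal_transformation f"
  shows "distr lborel borel f = lborel"
proof (rule measure_eqI)
  note [measurable] = borel_measurable_orthogonal[OF f]
  obtain g where g: "\<And>y. f (g y) = y"
    using orthogonal_transformation_surj[OF f] by (metis surj_def)
  have lin: "f (x + y) = f x + f y" for x y
    using orthogonal_transformation_linear[OF f] by (rule linear_add)
  have trans: "(\<integral>\<^sup>+x. F x \<partial>lborel) = (\<integral>\<^sup>+x. F (c + x) \<partial>lborel)"
    if [measurable]: "F \<in> borel_measurable borel" for F and c :: "real ^ 'n"
    by (subst lborel_distr_plus[of c, symmetric], subst nn_integral_distr) auto
  have refl: "(\<integral>\<^sup>+x. F x \<partial>lborel) = (\<integral>\<^sup>+x. F (c - x) \<partial>lborel)"
    if [measurable]: "F \<in> borel_measurable borel" for F and c :: "real ^ 'n"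
    by (subst lborel_affine[of "-1" c], simp, subst nn_integral_density)
      (auto simp: nn_integral_distr)
  fix A assume "A \<in> sets (distr lborel borel f)"
  then have A [measurable]: "A \<in> sets borel" by simp
  define B where "B = ball (0 :: real ^ 'n) 1"
  have B [measurable]: "B \<in> sets borel" by (simp add: B_def)
  have fB: "indicator B (f x) = (indicator B x :: ennreal)" for x
    using f by (simp add: B_def indicator_def orthogonal_transformation_norm)
  have em: "emeasure lborel C = (\<integral>\<^sup>+x. indicator C x \<partial>lborel)"
    if "C \<in> sets borel" for C :: "(real ^ 'n) set"
    using that by simp
  have dm: "emeasure (distr lborel borel f) A = (\<integral>\<^sup>+x. indicator A (f x) \<partial>lborel)"
    by (subst nn_integral_indicator[symmetric], simp, subst nn_integral_distr) auto
  have "emeasure (distr lborel borel f) A * emeasure lborel B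
      = (\<integral>\<^sup>+x. indicator A (f x) * emeasure lborel B \<partial>lborel)"
    by (simp add: dm nn_integral_multc)
  also have "\<dots> = (\<integral>\<^sup>+x. \<integral>\<^sup>+y. indicator A (f x) * indicator B (f x + y) \<partial>lborel \<partial>lborel)"
  proof (rule nn_integral_cong)
    fix x
    have "emeasure lborel B = (\<integral>\<^sup>+y. indicator B (f x + y) \<partial>lborel)"
      by (subst em[OF B]) (rule trans, measurable)
    then show "indicator A (f x) * emeasure lborel B
        = (\<integral>\<^sup>+y. indicator A (f x) * indicator B (f x + y) \<partial>lborel)"
      by (simp add: nn_integral_cmult)
  qed
  also have "\<dots> = (\<integral>\<^sup>+y. \<integral>\<^sup>+x. indicator A (f x) * indicator B (f x + y) \<partial>lborel \<partial>lborel)"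
    by (rule lborel_pair.Fubini'[symmetric]) measurable
  also have "\<dots> = (\<integral>\<^sup>+y. \<integral>\<^sup>+x. indicator A (f x - y) * indicator B x \<partial>lborel \<partial>lborel)"
  proof (rule nn_integral_cong)
    fix y
    have g': "f (- g y + x) = f x - y" for x
      using linear_neg[OF orthogonal_transformation_linear[OF f]] by (simp only: lin g) simp
    show "(\<integral>\<^sup>+x. indicator A (f x) * indicator B (f x + y) \<partial>lborel)
        = (\<integral>\<^sup>+x. indicator A (f x - y) * indicator B x \<partial>lborel)"
      by (subst trans[of _ "- g y"]) (simp_all only: g' diff_add_cancel fB, measurable)
  qed
  also have "\<dots> = (\<integral>\<^sup>+x. \<integral>\<^sup>+y. indicator A (f x - y) * indicator B x \<partial>lborel \<partial>lborel)"
    by (rule lborel_pair.Fubini') measurable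
  also have "\<dots> = (\<integral>\<^sup>+x. emeasure lborel A * indicator B x \<partial>lborel)"
  proof (rule nn_integral_cong)
    fix x
    have "emeasure lborel A = (\<integral>\<^sup>+y. indicator A (f x - y) \<partial>lborel)"
      by (subst em[OF A]) (rule refl, measurable)
    then show "(\<integral>\<^sup>+y. indicator A (f x - y) * indicator B x \<partial>lborel)
        = emeasure lborel A * indicator B x"
      by (simp add: nn_integral_multc)
  qed
  also have "\<dots> = emeasure lborel A * emeasure lborel B"
    by (simp add: nn_integral_cmult)
  finally show "emeasure (distr lborel borel f) A = emeasure lborel A"
    by (subst (asm) (1 2) mult.commute, subst (asm) ennreal_mult_cancel_left)
      (auto simp: B_def emeasure_ball unit_ball_vol_pos[THEN less_imp_neq, symmetric])
qed simp

lemma ex_haar_on_sphere: "\<exists>\<sigma> :: (real ^ 'n) measure. haar_on_sphere \<sigma>"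
proof -
  obtain e :: "real ^ 'n" where e: "norm e = 1"
    using vector_choose_size[of 1] by auto
  define U where "U = (uniform_measure lborel (ball 0 1) :: (real ^ 'n) measure)"
  define g where "g x = (if x = 0 then e else x /\<^sub>R norm x)" for x :: "real ^ 'n"
  have sU [measurable_cong]: "sets U = sets borel" by (simp add: U_def)
  have pU: "prob_space U" unfolding U_def
    by (rule prob_space_uniform_measure) (simp_all add: emeasure_ball unit_ball_vol_pos[THEN less_imp_neq, symmetric])
  have g_meas [measurable]: "g \<in> borel \<rightarrow>\<^sub>M borel_sphere"
  proof (rule measurable_restrict_space2)
    show "g \<in> borel_measurable borel"
      unfolding g_def by measurable
  qed (auto simp: g_def e)
  have inv: "distr U borel f = U" if f: "orthogonal_transformation f" for f
  proof (rule measure_eqI)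
    note [measurable] = borel_measurable_orthogonal[OF f]
    fix A assume "A \<in> sets (distr U borel f)"
    then have [measurable]: "A \<in> sets borel" by simp
    have "f -` A \<inter> ball 0 1 = f -` (A \<inter> ball 0 1)"
      using f by (auto simp: orthogonal_transformation_norm)
    moreover have "emeasure lborel (f -` (A \<inter> ball 0 1)) = emeasure lborel (A \<inter> ball 0 1)"
      using emeasure_distr[of f lborel borel "A \<inter> ball 0 1"] by (simp add: distr_lborel_orthogonal[OF f])
    moreover have "f -` A \<in> sets borel"
      using measurable_sets_borel[of f borel A] by simp
    ultimately show "emeasure (distr U borel f) A = emeasure U A"
      by (simp add: emeasure_distr U_def Int_commute)
  qed (simp add: sU)
  have nz: "AE x in U. x \<noteq> 0"
    unfolding U_def by (rule AE_uniform_measureI) (auto intro: AE_mp[OF AE_lborel_singleton])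
  have "haar_on_sphere (distr U borel_sphere g)"
    unfolding haar_on_sphere_def borel_prob_on_sphere_def
  proof (intro conjI allI impI)
    show "prob_space (distr U borel_sphere g)"
      using pU by (rule prob_space.prob_space_distr) simp
    fix f :: "real ^ 'n \<Rightarrow> real ^ 'n" assume f: "orthogonal_transformation f"
    note [measurable] = borel_measurable_orthogonal[OF f]
    have fs [measurable]: "f \<in> borel_sphere \<rightarrow>\<^sub>M borel_sphere"
      using f by (intro measurable_restrict_space3) (auto simp: orthogonal_transformation_norm)
    have "distr (distr U borel_sphere g) borel_sphere f = distr U borel_sphere (f \<circ> g)"
      by (rule distr_distr) measurable
    also have "\<dots> = distr U borel_sphere (g \<circ> f)"
    proof (rule distr_cong_AE)
      show "AE x in U. (f \<circ> g) x = (g \<circ> f) x"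
        using nz
      proof eventually_elim
        fix x :: "real ^ 'n" assume "x \<noteq> 0"
        moreover from this have "f x \<noteq> 0"
          using orthogonal_transformation_norm[OF f, of x] by (metis norm_eq_zero)
        ultimately show "(f \<circ> g) x = (g \<circ> f) x"
          using linear_scale[OF orthogonal_transformation_linear[OF f]]
          by (simp add: g_def orthogonal_transformation_norm[OF f])
      qed
      show "f \<circ> g \<in> U \<rightarrow>\<^sub>M borel_sphere" "g \<circ> f \<in> U \<rightarrow>\<^sub>M borel_sphere"
        by measurable
    qed simp_all
    also have "\<dots> = distr (distr U borel f) borel_sphere g"
      by (rule distr_distr[symmetric]) measurable
    finally show "distr (distr U borel_sphere g) borel_sphere f = distr U borel_sphere g"
      by (simp add: inv f)
  qed simp
  then show ?thesis by blast
qed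

end

theory Submission
  imports Defs
begin

text \<open>If \<open>u\<close> is orthogonal to \<open>\<gamma> s\<close>, then \<open>\<bar>\<gamma> t \<bullet> u\<bar>\<close> is at most of order \<open>\<bar>t - s\<bar>\<close> for
  \<open>t\<close> near \<open>s\<close>, and \<open>1 / \<bar>t - s\<bar>\<close> is not integrable over a set of \<open>t\<close> that has positive density at
  \<open>s\<close>. So the potential is infinite at every \<open>u\<close> orthogonal to such a point of the arc, and as \<open>s\<close>
  moves the great spheres orthogonal to \<open>\<gamma> s\<close> sweep out a set of positive measure, because
  \<open>\<gamma>' s\<close> is nonzero and orthogonal to \<open>\<gamma> s\<close>.

  The proof below makes this quantitative by a first moment argument. Choose a set \<open>K\<close>
  of parameters of positive measure on which the density \<open>h\<close> is at least \<open>c > 0\<close>, inside an interval so short that \<open>\<gamma>'\<close> is nearly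
  constant. For \<open>\<epsilon> = 1 / Suc n\<close> let \<open>N n u\<close> be \<open>1 / \<epsilon>\<close> times the length of the set of
  \<open>s \<in> K\<close> with \<open>\<bar>\<gamma> s \<bullet> u\<bar> \<le> \<epsilon>\<close> and \<open>\<bar>\<gamma>' s \<bullet> u\<bar> \<ge> \<delta> * norm (\<gamma>' s)\<close>. Three facts
  contradict each other if the potential is finite for almost every \<open>u\<close>:

  \<^item> The mean of \<open>N n\<close> over the sphere is bounded away from \<open>0\<close>. By Tonelli's theorem this is an
    estimate for fixed \<open>s\<close>, namely that the slab \<open>\<bar>\<gamma> s \<bullet> u\<bar> \<le> \<epsilon>\<close> has measure at least a
    constant times \<open>\<epsilon>\<close>, even away from the vectors orthogonal to \<open>\<gamma>' s\<close>
    (\<open>haar_slab_lower_bound\<close>, by covering with rotated copies).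

  \<^item> \<open>N n\<close> is bounded uniformly in \<open>n\<close> and \<open>u\<close>. If the set above is nonempty, then
    \<open>t \<mapsto> \<gamma> t \<bullet> u\<close> is strictly monotone, with speed bounded below, on the whole interval
    (\<open>ex_uniform_transversality_interval\<close>), so it stays near \<open>0\<close> only for a time of order
    \<open>\<epsilon>\<close> (\<open>emeasure_transversal_sublevel_le\<close>).

  \<^item> \<open>N n u\<close> tends to \<open>0\<close> wherever the potential is finite
    (\<open>scaled_sublevel_tendsto_0\<close>).

  The abstract form of the contradiction is \<open>infinite_potential_of_transversal_family\<close>.\<close>

section \<open>Slabs on the sphere\<close>

lemma sets_haar_on_sphere:
  assumes "haar_on_sphere \<sigma>"
  shows "sets \<sigma> = sets borel_sphere" "space \<sigma> = sphere 0 1" "prob_space \<sigma>"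
proof -
  show *: "sets \<sigma> = sets borel_sphere" and "prob_space \<sigma>"
    using assms by (auto simp: haar_on_sphere_def borel_prob_on_sphere_def)
  show "space \<sigma> = sphere 0 1"
    using sets_eq_imp_space_eq[OF *] by (simp add: space_restrict_space)
qed

lemma sphere_set_in_sets:
  fixes \<sigma> :: "(real ^ 'n) measure"
  assumes "sets \<sigma> = sets borel_sphere" "{u. P u} \<in> sets borel"
  shows "{u \<in> sphere 0 1. P u} \<in> sets \<sigma>"
proof -
  have "sphere 0 1 \<inter> {u. P u} \<in> sets \<sigma>"
    unfolding assms(1) using assms(2) by (simp add: sets_restrict_space)
  then show ?thesis by (simp add: Int_def)
qed

text \<open>The sets are described by predicates so that the rotated copy of a slab is obtained by
  substituting \<open>f u\<close> for \<open>u\<close>.\<close>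

lemma haar_on_sphere_invariant:
  fixes \<sigma> :: "(real ^ 'n) measure"
  assumes \<sigma>: "haar_on_sphere \<sigma>" and f: "orthogonal_transformation f"
    and P: "{u. P u} \<in> sets borel"
  shows "measure \<sigma> {u \<in> sphere 0 1. P (f u)} = measure \<sigma> {u \<in> sphere 0 1. P u}"
proof -
  note s = sets_haar_on_sphere[OF \<sigma>]
  have "f \<in> borel_sphere \<rightarrow>\<^sub>M borel_sphere"
    using f borel_measurable_orthogonal[OF f]
    by (intro measurable_restrict_space3) (auto simp: orthogonal_transformation_norm)
  then have fm: "f \<in> \<sigma> \<rightarrow>\<^sub>M borel_sphere"
    by (simp cong: measurable_cong_sets add: s(1))
  have "measure \<sigma> {u \<in> sphere 0 1. P u} = measure (distr \<sigma> borel_sphere f) {u \<in> sphere 0 1. P u}"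
    using \<sigma> f by (simp add: haar_on_sphere_def)
  also have "\<dots> = measure \<sigma> (f -` {u \<in> sphere 0 1. P u} \<inter> space \<sigma>)"
    using fm sphere_set_in_sets[OF s(1) P] by (intro measure_distr) (simp_all add: s(1))
  also have "f -` {u \<in> sphere 0 1. P u} \<inter> space \<sigma> = {u \<in> sphere 0 1. P (f u)}"
    using f by (auto simp: s(2) orthogonal_transformation_norm)
  finally show ?thesis by simp
qed

text \<open>Some coordinate of a unit vector is at least \<open>1 / p\<close> in absolute value, \<open>p\<close> being the dimension,
  so the sets \<open>{\<bar>u $ i\<bar> \<ge> 1 / p}\<close> cover the sphere. Orthogonal maps permute the
  directions transitively, hence these \<open>p\<close> sets and the one belonging to \<open>e\<close> have the same
  measure.\<close>

lemma haar_cap_pair_lower_bound: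
  fixes \<sigma> :: "(real ^ 'n) measure" and e :: "real ^ 'n"
  assumes \<sigma>: "haar_on_sphere \<sigma>" and e: "norm e = 1"
  shows "1 / CARD('n) \<le> measure \<sigma> {u \<in> sphere 0 1. 1 / CARD('n) \<le> \<bar>e \<bullet> u\<bar>}"
proof -
  note s = sets_haar_on_sphere[OF \<sigma>]
  interpret prob_space \<sigma> by (fact s(3))
  define p where "p = real CARD('n)"
  have p: "p > 0" by (simp add: p_def)
  let ?S = "\<lambda>a :: real ^ 'n. {u \<in> sphere 0 1. 1 / p \<le> \<bar>a \<bullet> u\<bar>}"
  have S: "?S a \<in> sets \<sigma>" for a
    by (rule sphere_set_in_sets[OF s(1)]) measurable
  have same: "measure \<sigma> (?S (axis i 1)) = measure \<sigma> (?S e)" for i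
  proof -
    obtain f where f: "orthogonal_transformation f" "f (axis i 1 :: real ^ 'n) = e"
      using orthogonal_transformation_exists_1[OF norm_axis_1[of i] e] .
    have "e \<bullet> f u = axis i 1 \<bullet> u" for u
      using f by (metis orthogonal_transformation_def)
    then show ?thesis
      using haar_on_sphere_invariant[OF \<sigma> f(1), of "\<lambda>u. 1 / p \<le> \<bar>e \<bullet> u\<bar>"] by simp
  qed
  have "sphere 0 1 \<subseteq> (\<Union>i. ?S (axis i 1))"
  proof (rule subsetI, rule ccontr)
    fix u :: "real ^ 'n"
    assume u: "u \<in> sphere 0 1" "u \<notin> (\<Union>i. ?S (axis i 1))"
    then have "\<bar>u $ i\<bar> < 1 / p" for i
      by (auto simp: inner_axis' not_le)
    then have "(\<Sum>i\<in>UNIV. \<bar>u $ i\<bar>) < (\<Sum>i\<in>(UNIV :: 'n set). 1 / p)"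
      by (intro sum_strict_mono) auto
    also have "\<dots> = 1" using p by (simp add: p_def)
    finally show False
      using norm_le_l1_cart[of u] u(1) by simp
  qed
  then have "1 \<le> measure \<sigma> (\<Union>i. ?S (axis i 1))"
    using finite_measure_mono[of "space \<sigma>" "\<Union>i. ?S (axis i 1)"] S prob_space
    by (auto simp: s(2))
  also have "\<dots> \<le> (\<Sum>i\<in>UNIV. measure \<sigma> (?S (axis i 1)))"
    using S by (intro finite_measure_subadditive_finite) auto
  also have "\<dots> = p * measure \<sigma> (?S e)"
    unfolding same by (simp add: p_def)
  finally show ?thesis
    using p by (simp add: p_def field_simps)
qed

text \<open>Only the components along \<open>a\<close> and \<open>e\<close> change; writing the map as \<open>u\<close> plus a
  correction in their span avoids a choice of basis for the orthogonal complement.\<close>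

lemma plane_rotation:
  fixes a e :: "'a :: euclidean_space"
  assumes "norm a = 1" "norm e = 1" "a \<bullet> e = 0"
  obtains f where "orthogonal_transformation f"
    "\<And>u. a \<bullet> f u = cos \<theta> * (a \<bullet> u) - sin \<theta> * (e \<bullet> u)"
    "\<And>u. e \<bullet> f u = sin \<theta> * (a \<bullet> u) + cos \<theta> * (e \<bullet> u)"
proof
  define \<alpha> where "\<alpha> u = (cos \<theta> - 1) * (a \<bullet> u) - sin \<theta> * (e \<bullet> u)" for u
  define \<beta> where "\<beta> u = sin \<theta> * (a \<bullet> u) + (cos \<theta> - 1) * (e \<bullet> u)" for u
  define f where "f u = u + \<alpha> u *\<^sub>R a + \<beta> u *\<^sub>R e" for u
  have ip: "a \<bullet> a = 1" "e \<bullet> e = 1" "a \<bullet> e = 0" "e \<bullet> a = 0"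
    using assms by (simp_all add: norm_eq_1 inner_commute)
  show af: "a \<bullet> f u = cos \<theta> * (a \<bullet> u) - sin \<theta> * (e \<bullet> u)" for u
    by (simp add: f_def \<alpha>_def inner_add_right ip algebra_simps)
  show ef: "e \<bullet> f u = sin \<theta> * (a \<bullet> u) + cos \<theta> * (e \<bullet> u)" for u
    by (simp add: f_def \<beta>_def inner_add_right ip algebra_simps)
  have lin: "linear f"
    by (rule linearI) (simp_all add: f_def \<alpha>_def \<beta>_def inner_add_right algebra_simps)
  have "norm (f u) = norm u" for u
  proof -
    have sc: "sin \<theta> ^ 2 = 1 - cos \<theta> ^ 2" by (rule sin_squared_eq)
    have "f u \<bullet> f u = u \<bullet> u + (\<alpha> u + a \<bullet> u)\<^sup>2 + (\<beta> u + e \<bullet> u)\<^sup>2 - (a \<bullet> u)\<^sup>2 - (e \<bullet> u)\<^sup>2"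
      by (simp add: f_def inner_add_left inner_add_right ip inner_commute[of u a]
          inner_commute[of u e] power2_eq_square distrib_left distrib_right)
    also have "\<dots> = u \<bullet> u"
      using sc unfolding \<alpha>_def \<beta>_def by algebra
    finally show ?thesis by (simp add: norm_eq_sqrt_inner)
  qed
  with lin show "orthogonal_transformation f"
    by (simp add: orthogonal_transformation)
qed

text \<open>The set whose measure is bounded below is a slab around the great sphere orthogonal to \<open>a\<close>, kept
  away from the vectors orthogonal to \<open>e\<close>. A vector \<open>u\<close> with \<open>\<bar>e \<bullet> u\<bar> \<ge> 1 / p\<close>
  has a projection of length at least \<open>1 / p\<close> to the plane of \<open>a\<close> and \<open>e\<close>, and rotating
  this plane by a suitable multiple of \<open>\<epsilon>\<close> brings the projection within angle \<open>\<epsilon>\<close> of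
  \<open>e\<close>, thus \<open>u\<close> into the slab. So at most \<open>8 / \<epsilon>\<close> rotated copies of the slab, all of
  the same measure, cover a set of measure at least \<open>1 / p\<close>.\<close>

lemma haar_slab_lower_bound:
  fixes \<sigma> :: "(real ^ 'n) measure" and a e :: "real ^ 'n"
  assumes \<sigma>: "haar_on_sphere \<sigma>"
    and ae: "norm a = 1" "norm e = 1" "a \<bullet> e = 0" and \<epsilon>: "0 < \<epsilon>" "\<epsilon> \<le> 1"
  shows "\<epsilon> / (8 * CARD('n))
    \<le> measure \<sigma> {u \<in> sphere 0 1. \<bar>a \<bullet> u\<bar> \<le> \<epsilon> \<and> 1 / (2 * CARD('n)) \<le> \<bar>e \<bullet> u\<bar>}"
proof -
  note s = sets_haar_on_sphere[OF \<sigma>]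
  interpret prob_space \<sigma> by (fact s(3))
  define p where "p = real CARD('n)"
  have p: "p \<ge> 1" by (simp add: p_def Suc_leI)
  define P where "P u \<longleftrightarrow> \<bar>a \<bullet> u\<bar> \<le> \<epsilon> \<and> 1 / (2 * p) \<le> \<bar>e \<bullet> u\<bar>" for u
  have P: "{u. P u} \<in> sets borel" unfolding P_def by measurable
  have "\<exists>f. orthogonal_transformation f \<and>
    (\<forall>u. a \<bullet> f u = cos \<theta> * (a \<bullet> u) - sin \<theta> * (e \<bullet> u)) \<and>
    (\<forall>u. e \<bullet> f u = sin \<theta> * (a \<bullet> u) + cos \<theta> * (e \<bullet> u))" for \<theta>
    using plane_rotation[OF ae, of \<theta>] by metis
  then obtain R where R: "\<And>\<theta>. orthogonal_transformation (R \<theta>)"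
    "\<And>\<theta> u. a \<bullet> R \<theta> u = cos \<theta> * (a \<bullet> u) - sin \<theta> * (e \<bullet> u)"
    "\<And>\<theta> u. e \<bullet> R \<theta> u = sin \<theta> * (a \<bullet> u) + cos \<theta> * (e \<bullet> u)"
    by metis
  define N where "N = nat \<lfloor>2 * pi / \<epsilon>\<rfloor>"
  let ?T = "\<lambda>k. {u \<in> sphere 0 1. P (R (real k * \<epsilon>) u)}"
  have T: "?T k \<in> sets \<sigma>" for k
  proof (rule sphere_set_in_sets[OF s(1)])
    note [measurable] = borel_measurable_orthogonal[OF R(1)[of "real k * \<epsilon>"]]
    show "{u. P (R (real k * \<epsilon>) u)} \<in> sets borel" unfolding P_def by measurable
  qed
  have cover: "{u \<in> sphere 0 1. 1 / p \<le> \<bar>e \<bullet> u\<bar>} \<subseteq> (\<Union>k\<in>{..N}. ?T k)"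
  proof safe
    fix u :: "real ^ 'n" assume u: "u \<in> sphere 0 1" "1 / p \<le> \<bar>e \<bullet> u\<bar>"
    \<comment> \<open>polar coordinates of the projection of \<open>u\<close>, with the angle measured from \<open>e\<close>\<close>
    define r where "r = sqrt ((e \<bullet> u)\<^sup>2 + (a \<bullet> u)\<^sup>2)"
    have er: "\<bar>e \<bullet> u\<bar> \<le> r" unfolding r_def by simp
    have "r > 0" using u(2) er p by (smt (verit) divide_pos_pos)
    have "((e \<bullet> u) / r)\<^sup>2 + ((a \<bullet> u) / r)\<^sup>2 = 1"
      using \<open>r > 0\<close> by (simp add: power_divide r_def add_pos_pos flip: add_divide_distrib) auto
    then obtain \<phi> where \<phi>: "0 \<le> \<phi>" "\<phi> < 2 * pi" "(e \<bullet> u) / r = cos \<phi>" "(a \<bullet> u) / r = sin \<phi>"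
      using sincos_total_2pi by metis
    then have eu: "e \<bullet> u = r * cos \<phi>" and au: "a \<bullet> u = r * sin \<phi>"
      using \<open>r > 0\<close> by (simp_all add: field_simps)
    \<comment> \<open>Bessel's inequality: the component orthogonal to the plane has nonnegative squared norm\<close>
    have "r \<le> 1"
    proof -
      have "a \<bullet> a = 1" "e \<bullet> e = 1" "u \<bullet> u = 1"
        using ae u(1) by (simp_all add: norm_eq_1)
      moreover have "0 \<le> (u - (a \<bullet> u) *\<^sub>R a - (e \<bullet> u) *\<^sub>R e) \<bullet> (u - (a \<bullet> u) *\<^sub>R a - (e \<bullet> u) *\<^sub>R e)"
        by simp
      ultimately have "(e \<bullet> u)\<^sup>2 + (a \<bullet> u)\<^sup>2 \<le> 1"
        using ae(3) by (simp add: inner_diff_left inner_diff_right inner_commute[of u a]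
            inner_commute[of u e] inner_commute[of e a] power2_eq_square)
      then show ?thesis by (simp add: r_def)
    qed
    \<comment> \<open>the angle left after rotating back by as many whole steps \<open>\<epsilon>\<close> as possible\<close>
    define k where "k = nat \<lfloor>\<phi> / \<epsilon>\<rfloor>"
    define \<psi> where "\<psi> = \<phi> - real k * \<epsilon>"
    have "real k = of_int \<lfloor>\<phi> / \<epsilon>\<rfloor>" using \<phi>(1) \<epsilon> by (simp add: k_def)
    then have "real k \<le> \<phi> / \<epsilon>" "\<phi> / \<epsilon> < real k + 1" by linarith+
    then have \<psi>: "0 \<le> \<psi>" "\<psi> \<le> \<epsilon>" using \<epsilon> by (simp_all add: \<psi>_def field_simps)
    have "k \<le> N"
      unfolding k_def N_def using \<phi>(2) \<epsilon>(1) by (intro nat_mono floor_mono divide_right_mono) auto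
    have aR: "a \<bullet> R (real k * \<epsilon>) u = r * sin \<psi>"
      unfolding R \<psi>_def sin_diff eu au by (simp add: algebra_simps)
    have eR: "e \<bullet> R (real k * \<epsilon>) u = r * cos \<psi>"
      unfolding R \<psi>_def cos_diff eu au by (simp add: algebra_simps)
    have "\<bar>r * sin \<psi>\<bar> \<le> 1 * \<epsilon>"
      unfolding abs_mult using \<open>r > 0\<close> \<open>r \<le> 1\<close> \<psi> abs_sin_x_le_abs_x[of \<psi>]
      by (intro mult_mono) auto
    moreover have "1 / (2 * p) \<le> \<bar>r * cos \<psi>\<bar>"
    proof -
      \<comment> \<open>\<open>\<epsilon> \<le> 1\<close> keeps the cosine above \<open>1 / 2\<close>; this is where half of \<open>1 / p\<close> is lost\<close>
      have "\<psi> \<le> pi / 3" using \<psi> \<epsilon> pi_gt3 by simp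
      then have "1 / 2 \<le> cos \<psi>"
        using cos_monotone_0_pi_le[of \<psi> "pi / 3"] \<psi> pi_gt3 by (simp add: cos_60)
      then have "1 / p * (1 / 2) \<le> r * cos \<psi>"
        using u(2) er p by (intro mult_mono) auto
      then show ?thesis by simp
    qed
    ultimately have "P (R (real k * \<epsilon>) u)"
      by (simp add: P_def aR eR)
    with u(1) \<open>k \<le> N\<close> show "u \<in> (\<Union>k\<in>{..N}. ?T k)" by auto
  qed
  have N: "real N + 1 \<le> 8 / \<epsilon>"
  proof -
    have "real N \<le> 2 * pi / \<epsilon>"
      unfolding N_def using \<epsilon> by (simp add: of_nat_nat)
    moreover have "2 * pi + \<epsilon> \<le> 8"
      using pi_approx \<epsilon> by simp
    ultimately show ?thesis using \<epsilon> by (simp add: field_simps)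
  qed
  have "1 / p \<le> measure \<sigma> {u \<in> sphere 0 1. 1 / p \<le> \<bar>e \<bullet> u\<bar>}"
    unfolding p_def by (rule haar_cap_pair_lower_bound[OF \<sigma> ae(2)])
  also have "\<dots> \<le> measure \<sigma> (\<Union>k\<in>{..N}. ?T k)"
    using cover T by (intro finite_measure_mono) auto
  also have "\<dots> \<le> (\<Sum>k\<in>{..N}. measure \<sigma> (?T k))"
    using T by (intro finite_measure_subadditive_finite) auto
  also have "\<dots> = (real N + 1) * measure \<sigma> {u \<in> sphere 0 1. P u}"
    unfolding haar_on_sphere_invariant[OF \<sigma> R(1) P] by simp
  also have "\<dots> \<le> 8 / \<epsilon> * measure \<sigma> {u \<in> sphere 0 1. P u}"
    using N by (intro mult_right_mono) auto
  finally have "\<epsilon> / (8 * p) \<le> measure \<sigma> {u \<in> sphere 0 1. P u}"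
    using \<epsilon> p by (simp add: field_simps)
  then show ?thesis by (simp add: P_def p_def)
qed

section \<open>Sublevel sets and divergence of the potential\<close>

text \<open>Holds because \<open>S\<close> lies in the closed interval of length \<open>d\<close> that starts at its infimum.\<close>

lemma emeasure_lborel_le_of_diameter:
  fixes S :: "real set"
  assumes d: "\<And>s t. s \<in> S \<Longrightarrow> t \<in> S \<Longrightarrow> s < t \<Longrightarrow> t - s \<le> d" and "0 \<le> d"
  shows "emeasure lborel S \<le> ennreal d"
proof (cases "S = {}")
  case False
  then obtain s where s: "s \<in> S" by auto
  have lb: "t - d \<le> x" if "x \<in> S" "t \<in> S" for x t
    using d[OF that] \<open>0 \<le> d\<close> by linarith
  then have "bdd_below S" using s by (intro bdd_belowI[of _ "s - d"]) auto
  moreover have "t - d \<le> Inf S" if "t \<in> S" for t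
    using False lb that by (intro cInf_greatest) auto
  ultimately have "S \<subseteq> {Inf S..Inf S + d}"
    by (force intro: cInf_lower)
  then have "emeasure lborel S \<le> emeasure lborel {Inf S..Inf S + d}"
    by (intro emeasure_mono) auto
  then show ?thesis using \<open>0 \<le> d\<close> by simp
qed auto

text \<open>A function that crosses zero with speed at least \<open>\<kappa>\<close> changes by at least
  \<open>\<kappa> * (t - s)\<close> between two times, by the mean value theorem; two times with values in
  \<open>[-\<epsilon>, \<epsilon>]\<close> are therefore close.\<close>

lemma emeasure_transversal_sublevel_le:
  fixes g g' :: "real \<Rightarrow> real"
  assumes I: "is_interval I"
    and g: "\<And>t. t \<in> I \<Longrightarrow> (g has_real_derivative g' t) (at t within I)"
    and \<kappa>: "0 < \<kappa>" and sgn: "(\<forall>t\<in>I. \<kappa> \<le> g' t) \<or> (\<forall>t\<in>I. g' t \<le> - \<kappa>)"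
    and "0 \<le> \<epsilon>" and S: "S \<subseteq> {s \<in> I. \<bar>g s\<bar> \<le> \<epsilon>}"
  shows "emeasure lborel S \<le> ennreal (2 * \<epsilon> / \<kappa>)"
proof (rule emeasure_lborel_le_of_diameter)
  fix s t assume "s \<in> S" "t \<in> S" "s < t"
  with S have st: "s \<in> I" "\<bar>g s\<bar> \<le> \<epsilon>" "t \<in> I" "\<bar>g t\<bar> \<le> \<epsilon>" "s < t" by auto
  have sub: "{s..t} \<subseteq> I"
    using I st(1,3) unfolding is_interval_1 subset_iff atLeastAtMost_iff by blast
  have "(g has_derivative (*) (g' x)) (at x within {s..t})" if "s \<le> x" "x \<le> t" for x
    using has_field_derivative_subset[OF g sub] sub that
    by (auto simp: has_field_derivative_def)
  from mvt_simple[OF \<open>s < t\<close> this] obtain x where x: "x \<in> {s<..<t}" "g t - g s = g' x * (t - s)"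
    by auto
  have "x \<in> I" using x sub by auto
  then have "\<kappa> \<le> \<bar>g' x\<bar>" using sgn by fastforce
  then have "\<kappa> * (t - s) \<le> \<bar>g t - g s\<bar>"
    using \<open>s < t\<close> unfolding x(2) abs_mult by (intro mult_mono) auto
  also have "\<dots> \<le> 2 * \<epsilon>" using st by auto
  finally show "t - s \<le> 2 * \<epsilon> / \<kappa>" using \<kappa> by (simp add: field_simps)
qed (use \<kappa> \<open>0 \<le> \<epsilon>\<close> in auto)

text \<open>On the sublevel set the integrand is at least \<open>Suc n\<close>, so the scaled measure is at most the
  integral of \<open>1 / \<bar>f\<bar>\<close> over the sublevel set. Integrability forces \<open>f\<close> to be nonzero
  almost everywhere; hence these sets shrink to a null set and dominated convergence applies.
  The contrapositive is the criterion for an infinite potential: enough mass near the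
  zeros of \<open>f\<close> at every scale.\<close>

lemma scaled_sublevel_tendsto_0:
  fixes f :: "'a \<Rightarrow> real"
  assumes [measurable]: "f \<in> borel_measurable M"
    and fin: "(\<integral>\<^sup>+ s. inverse (ennreal \<bar>f s\<bar>) \<partial>M) < \<infinity>"
  shows "(\<lambda>n. ennreal (Suc n) * emeasure M {s \<in> space M. \<bar>f s\<bar> \<le> 1 / Suc n}) \<longlonglongrightarrow> 0"
proof (rule tendsto_sandwich[where f = "\<lambda>_. 0"])
  define S where "S n = {s \<in> space M. \<bar>f s\<bar> \<le> 1 / Suc n}" for n :: nat
  have [measurable]: "S n \<in> sets M" for n unfolding S_def by measurable
  let ?v = "\<lambda>n s. inverse (ennreal \<bar>f s\<bar>) * indicator (S n) s"
  have "(\<lambda>n. \<integral>\<^sup>+ s. ?v n s \<partial>M) \<longlonglongrightarrow> (\<integral>\<^sup>+ s. 0 \<partial>M)"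
  proof (rule nn_integral_dominated_convergence[where w = "\<lambda>s. inverse (ennreal \<bar>f s\<bar>)"])
    show "AE s in M. ?v n s \<le> inverse (ennreal \<bar>f s\<bar>)" for n
      by (intro AE_I2) (auto split: split_indicator)
    have "AE s in M. inverse (ennreal \<bar>f s\<bar>) \<noteq> \<infinity>"
      using fin by (intro nn_integral_noteq_infinite) auto
    then show "AE s in M. (\<lambda>n. ?v n s) \<longlonglongrightarrow> 0"
    proof eventually_elim
      fix s assume "inverse (ennreal \<bar>f s\<bar>) \<noteq> \<infinity>"
      then have "0 < \<bar>f s\<bar>" by auto
      then have "eventually (\<lambda>n. 1 / Suc n < \<bar>f s\<bar>) sequentially"
        using LIMSEQ_inverse_real_of_nat[THEN order_tendstoD(2)] by (simp add: inverse_eq_divide)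
      then have "eventually (\<lambda>n. ?v n s = 0) sequentially"
        by eventually_elim (auto simp: S_def)
      then show "(\<lambda>n. ?v n s) \<longlonglongrightarrow> 0" by (rule tendsto_eventually)
    qed
  qed (use fin in auto)
  then show "(\<lambda>n. \<integral>\<^sup>+ s. ?v n s \<partial>M) \<longlonglongrightarrow> 0" by simp
  show "\<forall>\<^sub>F n in sequentially. ennreal (Suc n) * emeasure M {s \<in> space M. \<bar>f s\<bar> \<le> 1 / Suc n}
      \<le> (\<integral>\<^sup>+ s. ?v n s \<partial>M)"
  proof (intro always_eventually allI)
    fix n
    have "ennreal (Suc n) * emeasure M (S n) = (\<integral>\<^sup>+ s. ennreal (Suc n) * indicator (S n) s \<partial>M)"
      by (simp add: nn_integral_cmult_indicator)
    also have "\<dots> \<le> (\<integral>\<^sup>+ s. ?v n s \<partial>M)"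
    proof (intro nn_integral_mono)
      fix s
      have "ennreal (Suc n) \<le> inverse (ennreal \<bar>f s\<bar>)" if "\<bar>f s\<bar> \<le> 1 / Suc n"
      proof (cases "f s = 0")
        case False
        have "real (Suc n) \<le> inverse \<bar>f s\<bar>" using that False by (simp add: field_simps)
        with False show ?thesis by (simp add: inverse_ennreal ennreal_leI del: of_nat_Suc)
      qed simp
      then show "ennreal (Suc n) * indicator (S n) s \<le> ?v n s"
        by (auto simp: S_def split: split_indicator)
    qed
    finally show "ennreal (Suc n) * emeasure M {s \<in> space M. \<bar>f s\<bar> \<le> 1 / Suc n} \<le> (\<integral>\<^sup>+ s. ?v n s \<partial>M)"
      by (simp add: S_def)
  qed
qed simp_all

text \<open>A first moment argument. Let \<open>N n u\<close> be the scaled measure of the \<open>s\<close> with \<open>\<bar>F s u\<bar> \<le> 1 / Suc n\<close>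
  and \<open>V s u\<close>, where \<open>V\<close> stands for transversality of the zero. Tonelli's theorem and the lower
  bound give \<open>N n\<close> a mean bounded away from zero, uniformly in \<open>n\<close>. The upper bound makes \<open>N n\<close>
  uniformly bounded, so this mean cannot be carried by smaller and smaller sets of \<open>u\<close>.
  If the potential were finite almost everywhere, \<open>N n\<close> would tend to zero almost everywhere, and
  by dominated convergence so would the means.\<close>

lemma infinite_potential_of_transversal_family:
  fixes M :: "'a measure" and \<sigma> :: "'b measure" and F :: "'a \<Rightarrow> 'b \<Rightarrow> real" and c C :: real
  assumes M: "finite_measure M" "emeasure M (space M) > 0" and \<sigma>: "finite_measure \<sigma>"
    and F [measurable]: "case_prod F \<in> borel_measurable (M \<Otimes>\<^sub>M \<sigma>)"
    and V [measurable]: "Measurable.pred (M \<Otimes>\<^sub>M \<sigma>) (case_prod V)"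
    and c: "c > 0"
    and lower: "\<And>s n. s \<in> space M \<Longrightarrow>
      c / real (Suc n) \<le> measure \<sigma> {u \<in> space \<sigma>. \<bar>F s u\<bar> \<le> 1 / Suc n \<and> V s u}"
    and upper: "\<And>u n. u \<in> space \<sigma> \<Longrightarrow>
      emeasure M {s \<in> space M. \<bar>F s u\<bar> \<le> 1 / Suc n \<and> V s u} \<le> ennreal (C / real (Suc n))"
  shows "emeasure \<sigma> {u \<in> space \<sigma>. (\<integral>\<^sup>+ s. inverse (ennreal \<bar>F s u\<bar>) \<partial>M) = \<infinity>} > 0"
proof (rule ccontr)
  interpret M: finite_measure M by fact
  interpret \<sigma>: finite_measure \<sigma> by fact
  interpret pair_sigma_finite M \<sigma> ..
  define I where "I u = (\<integral>\<^sup>+ s. inverse (ennreal \<bar>F s u\<bar>) \<partial>M)" for u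
  have [measurable]: "I \<in> borel_measurable \<sigma>"
    unfolding I_def by measurable
  define A where "A n s u \<longleftrightarrow> \<bar>F s u\<bar> \<le> 1 / Suc n \<and> V s u" for n :: nat and s u
  have A [measurable]: "Measurable.pred (M \<Otimes>\<^sub>M \<sigma>) (case_prod (A n))" for n
    unfolding A_def by measurable
  define N where "N n u = ennreal (Suc n) * emeasure M {s \<in> space M. A n s u}" for n u
  \<comment> \<open>for \<open>u\<close> outside the space the section need not be measurable, hence the restriction\<close>
  have N_eq: "N n u = ennreal (Suc n) * (\<integral>\<^sup>+ s. indicator {x. case_prod (A n) x} (s, u) \<partial>M)"
    if [measurable]: "u \<in> space \<sigma>" for n u
  proof -
    have [measurable]: "Measurable.pred M (\<lambda>s. A n s u)" by measurable
    have "(\<integral>\<^sup>+ s. indicator {x. case_prod (A n) x} (s, u) \<partial>M)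
        = (\<integral>\<^sup>+ s. indicator {s \<in> space M. A n s u} s \<partial>M)"
      by (intro nn_integral_cong) (auto split: split_indicator)
    then show ?thesis by (simp add: N_def)
  qed
  have N [measurable]: "N n \<in> borel_measurable \<sigma>" for n
    by (subst measurable_cong[OF N_eq]) measurable
  have lim: "(\<lambda>n. \<integral>\<^sup>+ u. N n u \<partial>\<sigma>) \<longlonglongrightarrow> (\<integral>\<^sup>+ u. 0 \<partial>\<sigma>)" if null: "AE u in \<sigma>. I u \<noteq> \<infinity>"
  proof (rule nn_integral_dominated_convergence[where w = "\<lambda>u. ennreal C"])
    have "N n u \<le> ennreal C" if "u \<in> space \<sigma>" for n u
    proof -
      have "N n u \<le> ennreal (Suc n) * ennreal (C / real (Suc n))"
        unfolding N_def A_def using upper[OF that, of n] by (intro mult_left_mono) auto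
      also have "\<dots> = ennreal C"
        by (simp add: ennreal_mult'[symmetric] del: of_nat_Suc)
      finally show ?thesis .
    qed
    then show "AE u in \<sigma>. N n u \<le> ennreal C" for n by auto
    show "(\<integral>\<^sup>+ u. ennreal C \<partial>\<sigma>) < \<infinity>"
      by (simp add: ennreal_mult_less_top ennreal_mult_eq_top_iff \<sigma>.emeasure_finite[simplified] less_top[symmetric])
    show "AE u in \<sigma>. (\<lambda>n. N n u) \<longlonglongrightarrow> 0"
      using null AE_space
    proof eventually_elim
      fix u assume I: "I u \<noteq> \<infinity>" and u [measurable]: "u \<in> space \<sigma>"
      have [measurable]: "(\<lambda>s. F s u) \<in> borel_measurable M" by measurable
      have "(\<lambda>n. ennreal (Suc n) * emeasure M {s \<in> space M. \<bar>F s u\<bar> \<le> 1 / Suc n}) \<longlonglongrightarrow> 0"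
        using I by (intro scaled_sublevel_tendsto_0) (auto simp: I_def less_top)
      then show "(\<lambda>n. N n u) \<longlonglongrightarrow> 0"
      proof (rule tendsto_sandwich[OF _ _ tendsto_const, rotated 2])
        show "\<forall>\<^sub>F n in sequentially. N n u
            \<le> ennreal (Suc n) * emeasure M {s \<in> space M. \<bar>F s u\<bar> \<le> 1 / Suc n}"
          unfolding N_def A_def
          by (intro always_eventually allI mult_left_mono emeasure_mono) auto
      qed auto
    qed
  qed simp_all
  have mass: "ennreal c * emeasure M (space M) \<le> (\<integral>\<^sup>+ u. N n u \<partial>\<sigma>)" for n
  proof -
    have "ennreal c \<le> ennreal (Suc n) * (\<integral>\<^sup>+ u. indicator {x. case_prod (A n) x} (s, u) \<partial>\<sigma>)"
      if [measurable]: "s \<in> space M" for s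
    proof -
      have [measurable]: "Measurable.pred \<sigma> (\<lambda>u. A n s u)" by measurable
      have eq: "(\<integral>\<^sup>+ u. indicator {x. case_prod (A n) x} (s, u) \<partial>\<sigma>)
          = (\<integral>\<^sup>+ u. indicator {u \<in> space \<sigma>. A n s u} u \<partial>\<sigma>)"
        by (intro nn_integral_cong) (auto split: split_indicator)
      have "ennreal c = ennreal (Suc n) * ennreal (c / real (Suc n))"
        by (simp add: ennreal_mult'[symmetric] del: of_nat_Suc)
      also have "\<dots> \<le> ennreal (Suc n) * emeasure \<sigma> {u \<in> space \<sigma>. A n s u}"
        using lower[OF that, of n] unfolding \<sigma>.emeasure_eq_measure A_def
        by (intro mult_left_mono ennreal_leI) auto
      finally show ?thesis by (simp add: eq)
    qed
    then have "(\<integral>\<^sup>+ s. ennreal c \<partial>M) \<le>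
        (\<integral>\<^sup>+ s. ennreal (Suc n) * (\<integral>\<^sup>+ u. indicator {x. case_prod (A n) x} (s, u) \<partial>\<sigma>) \<partial>M)"
      by (intro nn_integral_mono)
    also have "\<dots> = ennreal (Suc n) *
        (\<integral>\<^sup>+ s. \<integral>\<^sup>+ u. indicator {x. case_prod (A n) x} (s, u) \<partial>\<sigma> \<partial>M)"
      by (intro nn_integral_cmult) measurable
    also have "(\<integral>\<^sup>+ s. \<integral>\<^sup>+ u. indicator {x. case_prod (A n) x} (s, u) \<partial>\<sigma> \<partial>M)
        = (\<integral>\<^sup>+ u. \<integral>\<^sup>+ s. indicator {x. case_prod (A n) x} (s, u) \<partial>M \<partial>\<sigma>)"
      by (rule Fubini'[symmetric]) measurable
    also have "ennreal (Suc n) * \<dots>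
        = (\<integral>\<^sup>+ u. ennreal (Suc n) * (\<integral>\<^sup>+ s. indicator {x. case_prod (A n) x} (s, u) \<partial>M) \<partial>\<sigma>)"
      by (intro nn_integral_cmult[symmetric]) measurable
    also have "\<dots> = (\<integral>\<^sup>+ u. N n u \<partial>\<sigma>)"
      by (intro nn_integral_cong) (simp add: N_eq)
    finally show ?thesis by simp
  qed
  assume "\<not> 0 < emeasure \<sigma> {u \<in> space \<sigma>. (\<integral>\<^sup>+ s. inverse (ennreal \<bar>F s u\<bar>) \<partial>M) = \<infinity>}"
  then have "emeasure \<sigma> {u \<in> space \<sigma>. \<not> I u \<noteq> \<infinity>} = 0"
    by (simp add: I_def)
  then have "AE u in \<sigma>. I u \<noteq> \<infinity>"
    by (subst AE_iff_measurable[OF _ refl]) measurable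
  from lim[OF this] mass have "ennreal c * emeasure M (space M) \<le> 0"
    by (intro LIMSEQ_le_const[of "\<lambda>n. \<integral>\<^sup>+ u. N n u \<partial>\<sigma>"]) auto
  with c M(2) show False by simp
qed

section \<open>Localization to parameters of positive measure\<close>

lemma ex_positive_measure_superlevel:
  fixes h :: "'a :: euclidean_space \<Rightarrow> real"
  assumes J: "J \<in> sets lebesgue" and h: "h \<in> borel_measurable (lebesgue_on J)"
    and pos: "emeasure lebesgue {s \<in> J. h s > 0} > 0"
  obtains c where "c > 0" "{s \<in> J. c \<le> h s} \<in> sets lebesgue" "emeasure lebesgue {s \<in> J. c \<le> h s} > 0"
proof -
  let ?E = "\<lambda>n. {s \<in> J. 1 / real (Suc n) \<le> h s}"
  have E: "{s \<in> J. c \<le> h s} \<in> sets lebesgue" for c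
  proof -
    have "{s \<in> space (lebesgue_on J). c \<le> h s} \<in> sets (lebesgue_on J)"
      using h by measurable
    then show ?thesis using J by (auto simp: sets_restrict_space_iff space_restrict_space)
  qed
  have "{s \<in> J. h s > 0} \<subseteq> (\<Union>n. ?E n)"
  proof safe
    fix s assume "0 < h s" "s \<in> J"
    then show "s \<in> (\<Union>n. ?E n)"
      using reals_Archimedean[of "h s"] by (auto simp: inverse_eq_divide intro: less_imp_le)
  qed
  then have "emeasure lebesgue {s \<in> J. h s > 0} \<le> emeasure lebesgue (\<Union>n. ?E n)"
    by (intro emeasure_mono sets.countable_UN) (auto intro: E)
  with pos have "emeasure lebesgue (\<Union>n. ?E n) \<noteq> 0" by auto
  then obtain n where "emeasure lebesgue (?E n) \<noteq> 0"
    using emeasure_UN_eq_0[of lebesgue ?E] E by blast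
  then show thesis
    using that[of "1 / real (Suc n)"] E by (simp add: zero_less_iff_neq_zero)
qed

text \<open>Otherwise \<open>S\<close> would be locally negligible, hence negligible by the Lindeloef property of the ambient space.\<close>

lemma ex_point_of_positive_local_measure:
  fixes S :: "'a :: euclidean_space set"
  assumes S: "S \<in> sets lebesgue" and pos: "emeasure lebesgue S > 0"
  obtains x where "x \<in> S" "\<And>r. r > 0 \<Longrightarrow> emeasure lebesgue (S \<inter> ball x r) > 0"
proof (rule ccontr)
  assume no: "\<not> thesis"
  have "negligible S"
    unfolding locally_negligible_alt[of S]
  proof
    fix x assume x: "x \<in> S"
    with no that obtain r where r: "r > 0" "\<not> emeasure lebesgue (S \<inter> ball x r) > 0"
      by blast
    have "negligible (S \<inter> ball x r)"
      using S r by (subst negligible_iff_emeasure0) auto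
    with r x show "\<exists>U. openin (top_of_set S) U \<and> x \<in> U \<and> negligible U"
      by (intro exI[of _ "S \<inter> ball x r"]) auto
  qed
  with pos S show False by (simp add: negligible_iff_emeasure0)
qed

lemma ex_borel_subset_of_positive_measure:
  fixes S :: "'a :: euclidean_space set"
  assumes "S \<in> sets lebesgue" "emeasure lebesgue S > 0"
  obtains K where "K \<in> sets borel" "K \<subseteq> S" "emeasure lborel K > 0"
proof
  show "main_part lborel S \<in> sets borel"
    using main_part_sets[OF assms(1)] by simp
  show "main_part lborel S \<subseteq> S"
    using main_part_null_part_Un[OF assms(1)] by blast
  show "emeasure lborel (main_part lborel S) > 0"
    using assms(2) by (simp add: emeasure_completion[OF assms(1)])
qed

section \<open>Geometry of the arc\<close>

text \<open>The derivative of the constant \<open>\<gamma> t \<bullet> \<gamma> t\<close> vanishes. An interval with more than one point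
  has no isolated points, which makes derivatives within it unique, even at an endpoint.\<close>

lemma sphere_curve_orthogonal_velocity:
  fixes \<gamma> :: "real \<Rightarrow> 'a :: real_inner"
  assumes J: "connected J" "s \<in> J" "J \<noteq> {s}" and \<gamma>: "\<gamma> ` J \<subseteq> sphere 0 1"
    and d: "(\<gamma> has_vector_derivative v) (at s within J)"
  shows "\<gamma> s \<bullet> v = 0"
proof -
  have "((\<lambda>t. \<gamma> t \<bullet> \<gamma> t) has_vector_derivative (\<gamma> s \<bullet> v + v \<bullet> \<gamma> s)) (at s within J)"
    using bounded_bilinear.has_vector_derivative[OF bounded_bilinear_inner d d] .
  moreover have "((\<lambda>t. \<gamma> t \<bullet> \<gamma> t) has_vector_derivative 0) (at s within J)"
    by (rule has_vector_derivative_transform[OF J(2) _ has_vector_derivative_const[of 1]])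
       (use \<gamma> in \<open>auto simp: norm_eq_1\<close>)
  moreover have "at s within J \<noteq> bot"
    using connected_imp_perfect[OF J(1,2)] J(2,3) by (auto simp: trivial_limit_within)
  ultimately have "\<gamma> s \<bullet> v + v \<bullet> \<gamma> s = 0"
    by (intro vector_derivative_unique_within)
  then show ?thesis by (simp add: inner_commute)
qed

text \<open>By continuity \<open>\<gamma>'\<close> varies so little near \<open>s0\<close> that a unit vector \<open>u\<close> which is well
  away from the orthogonal complement of one velocity has inner products of the same sign, and of
  size at least \<open>\<kappa>\<close>, with all nearby velocities. The same \<open>r\<close> and \<open>\<kappa>\<close> serve all \<open>u\<close>.\<close>

lemma ex_uniform_transversality_interval:
  fixes \<gamma>' :: "real \<Rightarrow> 'a :: euclidean_space"
  assumes c: "continuous_on J \<gamma>'" and s0: "s0 \<in> J" "\<gamma>' s0 \<noteq> 0" and \<delta>: "0 < \<delta>" "\<delta> \<le> 1"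
  obtains r \<kappa> where "r > 0" "\<kappa> > 0"
    "\<And>s u. s \<in> J \<inter> ball s0 r \<Longrightarrow> norm u = 1 \<Longrightarrow> \<delta> * norm (\<gamma>' s) \<le> \<bar>\<gamma>' s \<bullet> u\<bar> \<Longrightarrow>
      (\<forall>t\<in>J \<inter> ball s0 r. \<kappa> \<le> \<gamma>' t \<bullet> u) \<or> (\<forall>t\<in>J \<inter> ball s0 r. \<gamma>' t \<bullet> u \<le> - \<kappa>)"
proof -
  \<comment> \<open>a quarter: one is lost in comparing \<open>norm (\<gamma>' s)\<close> with \<open>norm (\<gamma>' s0)\<close>, two in moving
    from \<open>s\<close> via \<open>s0\<close> to \<open>t\<close>, and one remains\<close>
  define \<kappa> where "\<kappa> = \<delta> * norm (\<gamma>' s0) / 4"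
  have \<kappa>: "\<kappa> > 0" using s0 \<delta> by (simp add: \<kappa>_def)
  obtain r where r: "r > 0" "\<And>t. t \<in> J \<Longrightarrow> dist t s0 < r \<Longrightarrow> dist (\<gamma>' t) (\<gamma>' s0) < \<kappa>"
    using c s0(1) \<kappa> unfolding continuous_on_iff by metis
  have near: "norm (\<gamma>' t - \<gamma>' s0) < \<kappa>" if "t \<in> J \<inter> ball s0 r" for t
    using r(2)[of t] that by (simp add: dist_commute dist_norm norm_minus_commute)
  show thesis
  proof (rule that[OF r(1) \<kappa>])
    fix s u assume s: "s \<in> J \<inter> ball s0 r" and u: "norm u = 1" "\<delta> * norm (\<gamma>' s) \<le> \<bar>\<gamma>' s \<bullet> u\<bar>"
    have "norm (\<gamma>' s0) - \<kappa> \<le> norm (\<gamma>' s)"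
      using near[OF s] norm_triangle_ineq2[of "\<gamma>' s0" "\<gamma>' s"] by (simp add: norm_minus_commute)
    then have "\<delta> * (norm (\<gamma>' s0) - \<kappa>) \<le> \<bar>\<gamma>' s \<bullet> u\<bar>"
      using u(2) \<delta> by (smt (verit) mult_left_mono)
    moreover have "\<delta> * \<kappa> \<le> \<kappa>" using \<delta> \<kappa> by simp
    ultimately have big: "3 * \<kappa> \<le> \<bar>\<gamma>' s \<bullet> u\<bar>"
      by (simp add: \<kappa>_def algebra_simps)
    have close: "\<bar>\<gamma>' t \<bullet> u - \<gamma>' s \<bullet> u\<bar> \<le> 2 * \<kappa>" if "t \<in> J \<inter> ball s0 r" for t
    proof -
      have "\<bar>\<gamma>' t \<bullet> u - \<gamma>' s \<bullet> u\<bar> \<le> norm (\<gamma>' t - \<gamma>' s)"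
        using Cauchy_Schwarz_ineq2[of "\<gamma>' t - \<gamma>' s" u] u(1) by (simp add: inner_diff_left)
      also have "\<dots> \<le> 2 * \<kappa>"
        using near[OF that] near[OF s] norm_triangle_ineq4[of "\<gamma>' t - \<gamma>' s0" "\<gamma>' s - \<gamma>' s0"] by simp
      finally show ?thesis .
    qed
    show "(\<forall>t\<in>J \<inter> ball s0 r. \<kappa> \<le> \<gamma>' t \<bullet> u) \<or> (\<forall>t\<in>J \<inter> ball s0 r. \<gamma>' t \<bullet> u \<le> - \<kappa>)"
    proof (cases "\<gamma>' s \<bullet> u \<ge> 0")
      case True
      then have "\<kappa> \<le> \<gamma>' t \<bullet> u" if "t \<in> J \<inter> ball s0 r" for t
        using close[OF that] big by linarith
      then show ?thesis by blast
    next
      case False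
      then have "\<gamma>' t \<bullet> u \<le> - \<kappa>" if "t \<in> J \<inter> ball s0 r" for t
        using close[OF that] big by linarith
      then show ?thesis by blast
    qed
  qed
qed

text \<open>Reduces the potential to an integral over a Borel set \<open>K\<close> of parameters with a density bounded
  below; replacing Lebesgue by Borel measurable sets makes the product with \<open>\<sigma>\<close>
  manageable.\<close>

lemma I_pot_ge_arc_integral:
  fixes \<gamma> :: "real \<Rightarrow> real ^ 'n"
  assumes \<mu>: "borel_prob_on_sphere \<mu>"
    and J: "is_interval J" and \<gamma>: "\<gamma> ` J \<subseteq> sphere 0 1" "C1_immersion_on \<gamma> J"
    and h: "h \<in> borel_measurable (lebesgue_on J)"
    and le: "\<forall>A\<in>sets borel_sphere. emeasure (arc_measure \<gamma> J h) A \<le> emeasure \<mu> A"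
    and K: "K \<in> sets borel" "K \<subseteq> J" "\<And>s. s \<in> K \<Longrightarrow> c \<le> h s"
  shows "ennreal c * (\<integral>\<^sup>+ s. inverse (ennreal \<bar>\<gamma> s \<bullet> u\<bar>) \<partial>restrict_space lborel K) \<le> I_pot \<mu> u"
proof -
  have [measurable]: "J \<in> sets borel"
    using J by (rule real_interval_borel_measurable)
  have \<gamma>m [measurable]: "\<gamma> \<in> lebesgue_on J \<rightarrow>\<^sub>M borel_sphere"
    using measurable_arc[OF J \<gamma>(2,1)] .
  note h [measurable]
  have im [measurable]: "(\<lambda>a. inverse (ennreal \<bar>a \<bullet> u\<bar>)) \<in> borel_measurable borel_sphere"
    by (rule measurable_restrict_space1) measurable
  have [measurable]: "\<gamma> \<in> borel_measurable (lebesgue_on J)"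
    using \<gamma>m by (simp add: measurable_restrict_space2_iff)
  have \<gamma>K [measurable]: "\<gamma> \<in> borel_measurable (restrict_space lborel K)"
  proof -
    have "continuous_on J \<gamma>"
      using \<gamma>(2) unfolding C1_immersion_on_def
      by (meson continuous_on_eq_continuous_within has_vector_derivative_continuous)
    then have "\<gamma> \<in> borel_measurable (restrict_space borel K)"
      using K(2) by (intro borel_measurable_continuous_on_restrict) (rule continuous_on_subset)
    then show ?thesis by (simp cong: measurable_cong_sets add: sets_restrict_space)
  qed
  have "ennreal c * (\<integral>\<^sup>+ s. inverse (ennreal \<bar>\<gamma> s \<bullet> u\<bar>) \<partial>restrict_space lborel K)
      = (\<integral>\<^sup>+ s. ennreal c * inverse (ennreal \<bar>\<gamma> s \<bullet> u\<bar>) \<partial>restrict_space lborel K)"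
    by (intro nn_integral_cmult[symmetric]) measurable
  also have "\<dots> = (\<integral>\<^sup>+ s. ennreal c * inverse (ennreal \<bar>\<gamma> s \<bullet> u\<bar>) * indicator K s \<partial>lebesgue)"
    using K(1) by (simp add: nn_integral_restrict_space nn_integral_completion)
  also have "\<dots> \<le> (\<integral>\<^sup>+ s. ennreal (h s) * inverse (ennreal \<bar>\<gamma> s \<bullet> u\<bar>) * indicator J s \<partial>lebesgue)"
    using K(2,3)
    by (intro nn_integral_mono) (auto split: split_indicator intro!: mult_right_mono ennreal_leI)
  also have "\<dots> = (\<integral>\<^sup>+ s. ennreal (h s) * inverse (ennreal \<bar>\<gamma> s \<bullet> u\<bar>) \<partial>lebesgue_on J)"
    by (subst nn_integral_restrict_space) auto
  also have "\<dots> = (\<integral>\<^sup>+ s. inverse (ennreal \<bar>\<gamma> s \<bullet> u\<bar>) \<partial>density (lebesgue_on J) (\<lambda>s. ennreal (h s)))"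
    by (rule nn_integral_density[symmetric]) measurable
  also have "\<dots> = (\<integral>\<^sup>+ a. inverse (ennreal \<bar>a \<bullet> u\<bar>) \<partial>arc_measure \<gamma> J h)"
    unfolding arc_measure_def by (rule nn_integral_distr[symmetric]) measurable
  also have "\<dots> \<le> (\<integral>\<^sup>+ a. inverse (ennreal \<bar>a \<bullet> u\<bar>) \<partial>\<mu>)"
  proof (rule nn_integral_mono_measure)
    show *: "sets (arc_measure \<gamma> J h) = sets \<mu>"
      using \<mu> by (simp add: arc_measure_def borel_prob_on_sphere_def)
    show "arc_measure \<gamma> J h \<le> \<mu>"
      using le by (subst le_measure[OF *]) (auto simp: arc_measure_def le_fun_def intro: emeasure_notin_sets)
  qed
  finally show ?thesis by (simp add: I_pot_def)
qed

section \<open>Infinite potential near an arc\<close>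

theorem theorem8p9:
  fixes \<mu> \<sigma> :: "(real ^ 'n) measure"
    and \<gamma> :: "real \<Rightarrow> real ^ 'n"
    and J :: "real set"
    and h :: "real \<Rightarrow> real"
  assumes "CARD('n) \<ge> 2"
    and "haar_on_sphere \<sigma>"
    and "borel_prob_on_sphere \<mu>"
    and "is_interval J"
    and "\<gamma> ` J \<subseteq> sphere 0 1"
    and "C1_immersion_on \<gamma> J"
    and "\<not> \<gamma> constant_on J"
    and "h \<in> borel_measurable (lebesgue_on J)"
    and "\<forall>s\<in>J. 0 \<le> h s"
    and "emeasure lebesgue {s \<in> J. h s > 0} > 0"
    and "\<forall>A\<in>sets borel_sphere. emeasure (arc_measure \<gamma> J h) A \<le> emeasure \<mu> A"
  shows "emeasure \<sigma> {u \<in> sphere 0 1. I_pot \<mu> u = \<infinity>} > 0"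
proof -
  note s = sets_haar_on_sphere[OF assms(2)]
  interpret \<sigma>: prob_space \<sigma> by (fact s(3))
  interpret \<mu>: prob_space \<mu> using assms(3) by (simp add: borel_prob_on_sphere_def)
  have sets_\<mu>: "sets \<mu> = sets borel_sphere"
    using assms(3) by (simp add: borel_prob_on_sphere_def)
  define p where "p = real CARD('n)"
  have p: "p \<ge> 1" by (simp add: p_def Suc_leI)
  define \<delta> where "\<delta> = 1 / (2 * p)"
  have \<delta>: "0 < \<delta>" "\<delta> \<le> 1" using p by (simp_all add: \<delta>_def field_simps)
  obtain \<gamma>' where \<gamma>': "continuous_on J \<gamma>'" "\<And>s. s \<in> J \<Longrightarrow> \<gamma>' s \<noteq> 0"
    "\<And>s. s \<in> J \<Longrightarrow> (\<gamma> has_vector_derivative \<gamma>' s) (at s within J)"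
    using assms(6) unfolding C1_immersion_on_def by blast
  have Jm: "J \<in> sets lebesgue"
    using real_interval_borel_measurable[OF assms(4)] by simp
  \<comment> \<open>localize: find a piece of the arc that carries mass with density at least \<open>c\<close> and on which the
    velocity is nearly constant\<close>
  obtain c where c: "c > 0" "{s \<in> J. c \<le> h s} \<in> sets lebesgue"
    "emeasure lebesgue {s \<in> J. c \<le> h s} > 0"
    using ex_positive_measure_superlevel[OF Jm assms(8,10)] .
  obtain s0 where s0: "s0 \<in> {s \<in> J. c \<le> h s}"
    "\<And>r. r > 0 \<Longrightarrow> emeasure lebesgue ({s \<in> J. c \<le> h s} \<inter> ball s0 r) > 0"
    using ex_point_of_positive_local_measure[OF c(2,3)] by blast
  obtain r \<kappa> where r: "r > 0" "\<kappa> > 0" and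
    trans: "\<And>s u. s \<in> J \<inter> ball s0 r \<Longrightarrow> norm u = 1 \<Longrightarrow> \<delta> * norm (\<gamma>' s) \<le> \<bar>\<gamma>' s \<bullet> u\<bar> \<Longrightarrow>
      (\<forall>t\<in>J \<inter> ball s0 r. \<kappa> \<le> \<gamma>' t \<bullet> u) \<or> (\<forall>t\<in>J \<inter> ball s0 r. \<gamma>' t \<bullet> u \<le> - \<kappa>)"
    using ex_uniform_transversality_interval[OF \<gamma>'(1) _ _ \<delta>, of s0] \<gamma>'(2) s0(1) by blast
  define I where "I = J \<inter> ball s0 r"
  have "ball s0 r = {s0 - r<..<s0 + r}" by (auto simp: dist_real_def)
  then have I: "is_interval I"
    using assms(4) unfolding I_def is_interval_1 by auto
  obtain K where K: "K \<in> sets borel" "K \<subseteq> {s \<in> J. c \<le> h s} \<inter> ball s0 r" "emeasure lborel K > 0"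
    by (rule ex_borel_subset_of_positive_measure[of "{s \<in> J. c \<le> h s} \<inter> ball s0 r"])
       (use c(2) s0(2)[OF r(1)] in auto)
  have KI: "K \<subseteq> I" and KJ: "K \<subseteq> J" using K(2) by (auto simp: I_def)
  define M where "M = restrict_space lborel K"
  have space_M: "space M = K" by (simp add: M_def space_restrict_space)
  have eM: "emeasure M A = emeasure lborel A" if "A \<subseteq> K" for A
    using K(1) that by (simp add: M_def emeasure_restrict_space)
  have "emeasure lborel K \<le> emeasure lborel (ball s0 r)"
    using K(2) by (intro emeasure_mono) auto
  also have "\<dots> < \<infinity>" by (rule emeasure_lborel_ball_finite)
  finally have fin: "finite_measure M"
    by (intro finite_measureI) (simp add: space_M eM)
  have cont: "f \<in> borel_measurable M" if "continuous_on J f" for f :: "real \<Rightarrow> real ^ 'n"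
  proof -
    have "f \<in> borel_measurable (restrict_space borel K)"
      using continuous_on_subset[OF that KJ] by (rule borel_measurable_continuous_on_restrict)
    then show ?thesis by (simp add: M_def cong: measurable_cong_sets restrict_space_sets_cong)
  qed
  have cont_\<gamma>: "continuous_on J \<gamma>"
    using \<gamma>'(3) by (meson continuous_on_eq_continuous_within has_vector_derivative_continuous)
  have id: "(\<lambda>u. u) \<in> borel_measurable N" if "sets N = sets borel_sphere" for N :: "(real ^ 'n) measure"
    by (subst measurable_cong_sets[OF that refl]) (simp add: measurable_restrict_space1)
  note \<gamma>_fst = measurable_compose[OF measurable_fst cont[OF cont_\<gamma>], of \<sigma>]
    and \<gamma>'_fst = measurable_compose[OF measurable_fst cont[OF \<gamma>'(1)], of \<sigma>]
    and snd_\<sigma> = measurable_compose[OF measurable_snd id[OF s(1)], of M]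
  \<comment> \<open>\<open>V\<close> compares with \<open>norm (\<gamma>' s)\<close> because the slab estimate is for the unit vector \<open>e\<close> in the
    direction of the velocity\<close>
  have "0 < emeasure \<sigma> {u \<in> space \<sigma>. (\<integral>\<^sup>+ s. inverse (ennreal \<bar>\<gamma> s \<bullet> u\<bar>) \<partial>M) = \<infinity>}"
  proof (rule infinite_potential_of_transversal_family[OF fin _ \<sigma>.finite_measure_axioms,
        where V = "\<lambda>s u. \<delta> * norm (\<gamma>' s) \<le> \<bar>\<gamma>' s \<bullet> u\<bar>" and c = "1 / (8 * p)" and C = "2 / \<kappa>"])
    show "emeasure M (space M) > 0" using K(3) by (simp add: space_M eM)
    show "0 < 1 / (8 * p)" using p by simp
    show "1 / (8 * p) / real (Suc n) \<le> measure \<sigma> {u \<in> space \<sigma>. \<bar>\<gamma> s \<bullet> u\<bar> \<le> 1 / Suc n \<and>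
        \<delta> * norm (\<gamma>' s) \<le> \<bar>\<gamma>' s \<bullet> u\<bar>}" if "s \<in> space M" for s n
    proof -
      have sJ: "s \<in> J" using that KJ by (auto simp: space_M)
      have "J \<noteq> {s}"
        using K(3) KJ emeasure_mono[of K "{s}" lborel] by auto
      have orth: "\<gamma> s \<bullet> \<gamma>' s = 0"
        using is_interval_connected[OF assms(4)] sJ \<open>J \<noteq> {s}\<close> assms(5) \<gamma>'(3)[OF sJ]
        by (rule sphere_curve_orthogonal_velocity)
      define e where "e = \<gamma>' s /\<^sub>R norm (\<gamma>' s)"
      have "1 / real (Suc n) / (8 * p) \<le> measure \<sigma> {u \<in> sphere 0 1. \<bar>\<gamma> s \<bullet> u\<bar> \<le> 1 / Suc n \<and>
          1 / (2 * p) \<le> \<bar>e \<bullet> u\<bar>}"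
        using haar_slab_lower_bound[OF assms(2), of "\<gamma> s" e "1 / real (Suc n)"]
          assms(5) sJ \<gamma>'(2)[OF sJ] orth by (auto simp: e_def p_def)
      moreover have "1 / (2 * p) \<le> \<bar>e \<bullet> u\<bar> \<longleftrightarrow> \<delta> * norm (\<gamma>' s) \<le> \<bar>\<gamma>' s \<bullet> u\<bar>" for u
        using \<gamma>'(2)[OF sJ] p by (simp add: e_def \<delta>_def abs_mult field_simps)
      ultimately show ?thesis by (simp add: s(2) mult.commute)
    qed
    show "emeasure M {s \<in> space M. \<bar>\<gamma> s \<bullet> u\<bar> \<le> 1 / Suc n \<and> \<delta> * norm (\<gamma>' s) \<le> \<bar>\<gamma>' s \<bullet> u\<bar>}
        \<le> ennreal (2 / \<kappa> / real (Suc n))" if "u \<in> space \<sigma>" for u n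
    \<comment> \<open>one transversal parameter makes the whole piece transversal; if there is none, the set is
      empty\<close>
    proof (cases "\<exists>s\<in>K. \<delta> * norm (\<gamma>' s) \<le> \<bar>\<gamma>' s \<bullet> u\<bar>")
      case True
      have "norm u = 1" using that by (simp add: s(2))
      with True trans KI have sgn:
        "(\<forall>t\<in>I. \<kappa> \<le> \<gamma>' t \<bullet> u) \<or> (\<forall>t\<in>I. \<gamma>' t \<bullet> u \<le> - \<kappa>)"
        unfolding I_def by blast
      have der: "((\<lambda>t. \<gamma> t \<bullet> u) has_real_derivative \<gamma>' t \<bullet> u) (at t within I)" if "t \<in> I" for t
      proof -
        have "(\<gamma> has_vector_derivative \<gamma>' t) (at t within I)"
          using that \<gamma>'(3) by (auto simp: I_def intro: has_vector_derivative_within_subset)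
        then show ?thesis
          unfolding has_real_derivative_iff_has_vector_derivative
          by (rule bounded_linear.has_vector_derivative[OF bounded_linear_inner_left])
      qed
      have "emeasure M {s \<in> space M. \<bar>\<gamma> s \<bullet> u\<bar> \<le> 1 / Suc n \<and> \<delta> * norm (\<gamma>' s) \<le> \<bar>\<gamma>' s \<bullet> u\<bar>}
          = emeasure lborel {s \<in> K. \<bar>\<gamma> s \<bullet> u\<bar> \<le> 1 / Suc n \<and> \<delta> * norm (\<gamma>' s) \<le> \<bar>\<gamma>' s \<bullet> u\<bar>}"
        by (subst eM) (auto simp: space_M)
      also have "\<dots> \<le> ennreal (2 * (1 / Suc n) / \<kappa>)"
        by (rule emeasure_transversal_sublevel_le[OF I der r(2) sgn]) (use KI in auto)
      finally show ?thesis by (simp add: mult.commute)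
    next
      case False
      then have "{s \<in> space M. \<bar>\<gamma> s \<bullet> u\<bar> \<le> 1 / Suc n \<and> \<delta> * norm (\<gamma>' s) \<le> \<bar>\<gamma>' s \<bullet> u\<bar>} = {}"
        by (auto simp: space_M)
      then show ?thesis by (simp only: emeasure_empty zero_le)
    qed
  next
    note [measurable] = \<gamma>_fst \<gamma>'_fst snd_\<sigma>
    show "(\<lambda>(s, u). \<gamma> s \<bullet> u) \<in> borel_measurable (M \<Otimes>\<^sub>M \<sigma>)"
      unfolding case_prod_beta by measurable
    show "Measurable.pred (M \<Otimes>\<^sub>M \<sigma>) (\<lambda>(s, u). \<delta> * norm (\<gamma>' s) \<le> \<bar>\<gamma>' s \<bullet> u\<bar>)"
      unfolding case_prod_beta by measurable
  qed
  also have "\<dots> \<le> emeasure \<sigma> {u \<in> sphere 0 1. I_pot \<mu> u = \<infinity>}"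
  proof (rule emeasure_mono)
    have "I_pot \<mu> u = \<infinity>" if "(\<integral>\<^sup>+ s. inverse (ennreal \<bar>\<gamma> s \<bullet> u\<bar>) \<partial>M) = \<infinity>" for u
    proof -
      have "ennreal c * (\<integral>\<^sup>+ s. inverse (ennreal \<bar>\<gamma> s \<bullet> u\<bar>) \<partial>M) \<le> I_pot \<mu> u"
        unfolding M_def
        by (rule I_pot_ge_arc_integral[OF assms(3,4,5,6,8,11) K(1) KJ]) (use K(2) in blast)
      with that c(1) show ?thesis by (simp add: ennreal_mult_top top_unique)
    qed
    then show "{u \<in> space \<sigma>. (\<integral>\<^sup>+ s. inverse (ennreal \<bar>\<gamma> s \<bullet> u\<bar>) \<partial>M) = \<infinity>}
        \<subseteq> {u \<in> sphere 0 1. I_pot \<mu> u = \<infinity>}"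
      by (auto simp: s(2))
    \<comment> \<open>needed because the measure of a nonmeasurable set is \<open>0\<close> by convention\<close>
    have "I_pot \<mu> \<in> borel_measurable \<sigma>"
      unfolding I_pot_def
    proof (rule \<mu>.borel_measurable_nn_integral)
      note [measurable] = measurable_compose[OF measurable_fst id[OF s(1)], of \<mu>]
        measurable_compose[OF measurable_snd id[OF sets_\<mu>], of \<sigma>]
      show "(\<lambda>(u, a). inverse (ennreal \<bar>a \<bullet> u\<bar>)) \<in> borel_measurable (\<sigma> \<Otimes>\<^sub>M \<mu>)"
        unfolding case_prod_beta by measurable
    qed
    then have "{u \<in> space \<sigma>. I_pot \<mu> u = \<infinity>} \<in> sets \<sigma>" by measurable
    then show "{u \<in> sphere 0 1. I_pot \<mu> u = \<infinity>} \<in> sets \<sigma>" by (simp add: s(2))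
  qed
  finally show ?thesis .
qed

end
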